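(* Let $\mathcal{O}$ be the set of overpartitions and let $\cdot$ be partition multiplication on $\mathcal{O}$. Then the group $(\mathcal{O},\cdot)$ is isomorphic to the group $(\mathbb{Q}^{+},\cdot)$ of positive rational numbers under rational number multiplication.
   Context: An integer partition is a finite (possibly empty) weakly decreasing sequence of positive integers, called its parts. An overpartition is an integer partition in which, for each part size that occurs, the first occurrence of that part size may be either marked with an overline or left unmarked. $\mathcal{O}$ denotes the set of all overpartitions, including the empty overpartition $\emptyset$ (no parts). Part-multiplicity notation: an overpartition $\alpha\in\mathcal{O}$ is written $\alpha=\langle 1^{\mu_1}2^{\mu_2}3^{\mu_3}\cdots i^{\mu_i}\cdots\rangle$ with $\mu_i\in\mathbb{Z}$ for each $i\in\mathbb{Z}^+$, where $|\mu_i|$ is the number of times $i$ occurs as a part of $\alpha$ (overlined or not), and $\mu_i$ is negative if and only if part size $i$ has an overline in $\alpha$. Only finitely many $\mu_i$ are nonzero, and $\emptyset=\langle 1^0 2^0 3^0\cdots\rangle$. This identifies overpartitions with finitely supported integer sequences $(\mu_i)_{i\ge 1}$. Partition multiplication on $\mathcal{O}$: for $\alpha=\langle 1^{\mu_1}2^{\mu_2}3^{\mu_3}\cdots\rangle$ and $\beta=\langle 1^{\nu_1}2^{\nu_2}3^{\nu_3}\cdots\rangle$, the product is the overpartition $\alpha\cdot\beta=\langle 1^{\mu_1+\nu_1}2^{\mu_2+\nu_2}3^{\mu_3+\nu_3}\cdots i^{\mu_i+\nu_i}\cdots\rangle$, in which part size $i$ has an overline if and only if $\mu_i+\nu_i<0$.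 With this operation $\mathcal{O}$ is an Abelian group with identity $\emptyset$. *)

theory Defs
  imports "HOL-Algebra.Algebra" "HOL-Library.Multiset" "HOL.Rat"
begin

definition is_partition :: "nat list \<Rightarrow> bool" where
  "is_partition xs \<longleftrightarrow> sorted_wrt (\<ge>) xs \<and> (\<forall>x\<in>set xs. 0 < x)"

(* In a pair (xs, S), xs is the underlying partition and S is the set of part sizes whose first
   occurrence in xs carries an overline. *)
definition overpartitions :: "(nat list \<times> nat set) set" where
  "overpartitions = {(xs, S). is_partition xs \<and> S \<subseteq> set xs}"

(* The exponent mu_i: its absolute value counts the occurrences of i, its sign records the
   overline. *)
definition signed_mult :: "nat list \<times> nat set \<Rightarrow> nat \<Rightarrow> int" where
  "signed_mult a i =
     (if i \<in> snd a then - int (count_list (fst a) i) else int (count_list (fst a) i))"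

(* The overpartition <1^(mu 1) 2^(mu 2) ...>; the value mu 0 is ignored. The description is proper
   for finitely supported mu, see signed_mult_overpartition_of. *)
definition overpartition_of :: "(nat \<Rightarrow> int) \<Rightarrow> nat list \<times> nat set" where
  "overpartition_of \<mu> = (THE a. a \<in> overpartitions \<and> (\<forall>i>0. signed_mult a i = \<mu> i))"

definition partition_mult ::
    "nat list \<times> nat set \<Rightarrow> nat list \<times> nat set \<Rightarrow> nat list \<times> nat set" where
  "partition_mult a b = overpartition_of (\<lambda>i. signed_mult a i + signed_mult b i)"

definition overpartition_group :: "(nat list \<times> nat set) monoid" where
  "overpartition_group =
     \<lparr>carrier = overpartitions, monoid.mult = partition_mult, one = ([], {})\<rparr>"

definition pos_rat_group :: "rat monoid" where
  "pos_rat_group = \<lparr>carrier = {q. 0 < q}, monoid.mult = (*), one = 1\<rparr>"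


lemma finite_signed_mult: "finite {i. signed_mult a i \<noteq> 0}"
  by (rule finite_subset[of _ "set (fst a)"])
    (auto simp: signed_mult_def count_list_0_iff split: if_splits)

lemma signed_mult_inject:
  assumes a: "a \<in> overpartitions" and b: "b \<in> overpartitions"
    and eq: "\<And>i. 0 < i \<Longrightarrow> signed_mult a i = signed_mult b i"
  shows "a = b"
proof -
  obtain xs S where a': "a = (xs, S)" by (cases a)
  obtain ys T where b': "b = (ys, T)" by (cases b)
  have xs: "sorted_wrt (\<ge>) xs" "0 \<notin> set xs" "S \<subseteq> set xs"
    and ys: "sorted_wrt (\<ge>) ys" "0 \<notin> set ys" "T \<subseteq> set ys"
    using a b by (auto simp: a' b' overpartitions_def is_partition_def)
  have abs_eq: "\<bar>signed_mult (zs, U) i\<bar> = int (count_list zs i)" for zs U i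
    by (simp add: signed_mult_def)
  have cnt: "count_list xs i = count_list ys i" for i
  proof (cases "i = 0")
    case True
    then show ?thesis using xs(2) ys(2) by (simp add: count_list_0_iff)
  next
    case False
    then show ?thesis using eq[of i] abs_eq[of xs S i] abs_eq[of ys T i] by (simp add: a' b')
  qed
  have "mset (rev xs) = mset (rev ys)"
    by (rule multiset_eqI) (simp add: count_mset cnt)
  moreover have "sorted (rev xs)" "sorted (rev ys)"
    using xs(1) ys(1) by (simp_all add: sorted_wrt_rev)
  ultimately have "rev xs = rev ys"
    by (metis properties_for_sort)
  then have xy: "xs = ys" by simp
  have neg: "i \<in> U \<longleftrightarrow> signed_mult (zs, U) i < 0" if "U \<subseteq> set zs" for zs U i
  proof -
    have "0 < count_list zs i" if "i \<in> U"
      using \<open>U \<subseteq> set zs\<close> that by (metis count_list_0_iff gr0I subsetD)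
    then show ?thesis by (auto simp: signed_mult_def)
  qed
  have "i \<in> S \<longleftrightarrow> i \<in> T" for i
  proof (cases "i = 0")
    case True
    then show ?thesis using xs ys by auto
  next
    case False
    then show ?thesis using neg[OF xs(3)] neg[OF ys(3)] eq[of i] by (simp add: a' b')
  qed
  then show ?thesis using xy by (auto simp: a' b')
qed

lemma overpartition_exists:
  assumes fin: "finite {i. \<mu> i \<noteq> 0}"
  shows "\<exists>a\<in>overpartitions. \<forall>i>0. signed_mult a i = \<mu> i"
proof -
  define A where "A = {i. 0 < i \<and> \<mu> i \<noteq> 0}"
  have finA: "finite A" by (rule finite_subset[OF _ fin]) (auto simp: A_def)
  define M where "M = (\<Sum>i\<in>A. replicate_mset (nat \<bar>\<mu> i\<bar>) i)"
  define xs where "xs = rev (sorted_list_of_multiset M)"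
  have M: "count M i = (if i \<in> A then nat \<bar>\<mu> i\<bar> else 0)" for i
  proof -
    have "count M i = (\<Sum>j\<in>A. if i = j then nat \<bar>\<mu> j\<bar> else 0)"
      by (simp only: M_def count_sum count_replicate_mset)
    then show ?thesis using finA by simp
  qed
  have cnt: "count_list xs i = (if i \<in> A then nat \<bar>\<mu> i\<bar> else 0)" for i
  proof -
    have "mset xs = M" by (simp add: xs_def)
    then have "count_list xs i = count M i" by (simp only: count_mset[symmetric])
    then show ?thesis by (simp only: M)
  qed
  have set: "set xs = A"
  proof (rule Set.set_eqI)
    fix i
    have "i \<in> set xs \<longleftrightarrow> count_list xs i \<noteq> 0" by (simp only: count_list_0_iff not_not)
    then show "i \<in> set xs \<longleftrightarrow> i \<in> A" unfolding cnt by (simp add: A_def)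
  qed
  have "sorted_wrt (\<ge>) xs"
    by (simp add: xs_def sorted_wrt_rev)
  then have "(xs, {i\<in>A. \<mu> i < 0}) \<in> overpartitions"
    using set by (auto simp: overpartitions_def is_partition_def A_def)
  moreover have "\<forall>i>0. signed_mult (xs, {i\<in>A. \<mu> i < 0}) i = \<mu> i"
    by (auto simp: signed_mult_def cnt A_def)
  ultimately show ?thesis by blast
qed

lemma
  assumes "finite {i. \<mu> i \<noteq> 0}"
  shows overpartition_of_closed: "overpartition_of \<mu> \<in> overpartitions"
    and signed_mult_overpartition_of: "0 < i \<Longrightarrow> signed_mult (overpartition_of \<mu>) i = \<mu> i"
proof -
  have "\<exists>!a. a \<in> overpartitions \<and> (\<forall>i>0. signed_mult a i = \<mu> i)"
    using overpartition_exists[OF assms] by (metis signed_mult_inject)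
  from theI'[OF this] show "overpartition_of \<mu> \<in> overpartitions"
    and "0 < i \<Longrightarrow> signed_mult (overpartition_of \<mu>) i = \<mu> i"
    by (auto simp: overpartition_of_def)
qed

lemma
  shows partition_mult_closed: "partition_mult a b \<in> overpartitions"
    and signed_mult_partition_mult:
      "0 < i \<Longrightarrow> signed_mult (partition_mult a b) i = signed_mult a i + signed_mult b i"
proof -
  have "finite {i. signed_mult a i + signed_mult b i \<noteq> 0}"
    by (rule finite_subset[OF _ finite_UnI[OF finite_signed_mult[of a] finite_signed_mult[of b]]])
      auto
  then show "partition_mult a b \<in> overpartitions"
    and "0 < i \<Longrightarrow> signed_mult (partition_mult a b) i = signed_mult a i + signed_mult b i"
    by (simp_all add: partition_mult_def overpartition_of_closed signed_mult_overpartition_of)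
qed

lemma empty_overpartition: "([], {}) \<in> overpartitions"
  by (simp add: overpartitions_def is_partition_def)

lemma signed_mult_empty: "signed_mult ([], {}) i = 0"
  by (simp add: signed_mult_def)

lemma comm_group_overpartition_group: "comm_group overpartition_group"
  unfolding overpartition_group_def
proof (rule comm_groupI, unfold monoid.simps partial_object.simps)
  fix a b c
  show "partition_mult a b \<in> overpartitions" by (rule partition_mult_closed)
  show "([], {}) \<in> overpartitions" by (rule empty_overpartition)
  show "partition_mult (partition_mult a b) c = partition_mult a (partition_mult b c)"
    by (rule signed_mult_inject[OF partition_mult_closed partition_mult_closed])
      (simp add: signed_mult_partition_mult)
  show "partition_mult a b = partition_mult b a"
    by (simp add: partition_mult_def add.commute)
  assume a: "a \<in> overpartitions"
  show "partition_mult ([], {}) a = a"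
    by (rule signed_mult_inject[OF partition_mult_closed a])
      (simp add: signed_mult_partition_mult signed_mult_empty)
  have "finite {i. - signed_mult a i \<noteq> 0}" using finite_signed_mult[of a] by simp
  from overpartition_exists[OF this] obtain d
    where d: "d \<in> overpartitions" "\<And>i. 0 < i \<Longrightarrow> signed_mult d i = - signed_mult a i" by blast
  have "partition_mult d a = ([], {})"
    by (rule signed_mult_inject[OF partition_mult_closed empty_overpartition])
      (simp add: signed_mult_partition_mult signed_mult_empty d(2))
  with d(1) show "\<exists>d\<in>overpartitions. partition_mult d a = ([], {})" by blast
qed

lemma comm_group_pos_rat_group: "comm_group pos_rat_group"
proof (rule comm_groupI)
  fix q assume "q \<in> carrier pos_rat_group"
  then show "\<exists>r\<in>carrier pos_rat_group. r \<otimes>\<^bsub>pos_rat_group\<^esub> q = \<one>\<^bsub>pos_rat_group\<^esub>"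
    by (intro bexI[of _ "inverse q"]) (auto simp: pos_rat_group_def)
qed (auto simp: pos_rat_group_def)

end

theory Submission
  imports Defs "HOL-Library.Infinite_Set" "HOL-Computational_Algebra.Primes"
begin

text \<open>
  Both groups are free Abelian on countably many generators. An overpartition is a finitely
  supported family of integers \<open>\<mu>\<^sub>1, \<mu>\<^sub>2, \<dots>\<close>, and partition multiplication adds such families. By
  unique factorization a positive rational is likewise a finitely supported family of integers,
  namely its exponents at the primes, and multiplication adds these. Matching part sizes with primes
  by any bijection therefore gives an isomorphism; the one used here sends the part size \<open>i\<close> to the
  \<open>i\<close>-th prime \<open>p\<^sub>i\<close>, so an overpartition is sent to the product of the \<open>p\<^sub>i\<close> to the power \<open>\<mu>\<^sub>i\<close>
  (\<open>prime_product\<close>).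

  Additivity is the law of exponents (\<open>prime_product_add\<close>). For the two halves of unique
  factorization, the positive and the negative exponents are separated, which writes the product as
  a quotient of two natural numbers. If the two are equal, so are their multiplicities at each
  \<open>p\<^sub>i\<close>, and an integer whose positive and negative parts agree is \<open>0\<close> (\<open>prime_product_eq_1D\<close>, the
  triviality of the kernel). Conversely the exponents of a given quotient are the differences of
  the multiplicities of numerator and denominator (\<open>prime_product_surj\<close>).
\<close>

hide_const (open) Divisibility.prime

text \<open>Enumerations of sets start at index \<open>0\<close> but part sizes at \<open>1\<close>, hence the shift.\<close>

definition nth_prime :: "nat \<Rightarrow> nat" where
  "nth_prime i = enumerate {p. prime p} (i - 1)"

lemma prime_nth_prime: "prime (nth_prime i)"
  using enumerate_in_set[OF primes_infinite, of "i - 1"] unfolding nth_prime_def by (rule CollectD)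

lemma nth_prime_pos [simp]: "0 < nth_prime i"
  using prime_nth_prime by (rule prime_gt_0_nat)

lemma nth_prime_eq_iff:
  assumes "0 < i" "0 < j"
  shows "nth_prime i = nth_prime j \<longleftrightarrow> i = j"
proof -
  have "inj (enumerate {p::nat. prime p})"
    using bij_enumerate[OF primes_infinite] by (simp add: bij_betw_def)
  then have "nth_prime i = nth_prime j \<longleftrightarrow> i - 1 = j - 1"
    unfolding nth_prime_def by (rule inj_eq)
  then show ?thesis using assms by linarith
qed

lemma prime_eq_nth_prime:
  assumes "prime p"
  obtains i where "0 < i" "p = nth_prime i"
proof -
  obtain n where "enumerate {p::nat. prime p} n = p"
    using enumerate_Ex[OF primes_infinite, of p] assms by blast
  then have "p = nth_prime (Suc n)" by (simp add: nth_prime_def)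
  then show thesis by (rule that[rotated]) simp
qed

lemma multiplicity_prod_nth_prime:
  assumes "finite I" "0 \<notin> I" "0 < i"
  shows "multiplicity (nth_prime i) (\<Prod>j\<in>I. nth_prime j ^ e j) = (if i \<in> I then e i else 0)"
proof -
  have "multiplicity (nth_prime i) (\<Prod>j\<in>I. nth_prime j ^ e j)
      = (\<Sum>j\<in>I. multiplicity (nth_prime i) (nth_prime j ^ e j))"
    using assms(1) prime_nth_prime
    by (subst prime_elem_multiplicity_prod_distrib) (simp_all add: image_iff less_imp_neq)
  also have "\<dots> = (\<Sum>j\<in>I. if i = j then e j else 0)"
  proof (rule sum.cong)
    fix j assume "j \<in> I"
    then have "0 < j" using assms by (metis gr0I)
    then show "multiplicity (nth_prime i) (nth_prime j ^ e j) = (if i = j then e j else 0)"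
      using nth_prime_eq_iff[OF \<open>0 < i\<close> \<open>0 < j\<close>] prime_nth_prime
      by (auto simp: multiplicity_distinct_prime_power)
  qed simp
  finally show ?thesis using assms by simp
qed

text \<open>
  The factorization of \<open>n\<close> over an index set that may be larger than needed: numerator and
  denominator of a fraction can then be factored over the same set.
\<close>

lemma prod_nth_prime_multiplicity:
  assumes "finite I" "0 \<notin> I" "0 < n"
    and dvd: "\<And>i. 0 < i \<Longrightarrow> nth_prime i dvd n \<Longrightarrow> i \<in> I"
  shows "(\<Prod>i\<in>I. nth_prime i ^ multiplicity (nth_prime i) n) = n"
proof (rule multiplicity_eq_nat)
  show "0 < (\<Prod>i\<in>I. nth_prime i ^ multiplicity (nth_prime i) n)"
    by (intro prod_pos) simp
  fix p :: nat assume "prime p"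
  then obtain i where i: "0 < i" "p = nth_prime i" by (rule prime_eq_nth_prime)
  show "multiplicity p (\<Prod>i\<in>I. nth_prime i ^ multiplicity (nth_prime i) n) = multiplicity p n"
    unfolding i(2) multiplicity_prod_nth_prime[OF assms(1,2) i(1)]
    using dvd[OF i(1)] not_dvd_imp_multiplicity_0[of "nth_prime i" n] by auto
qed fact

definition prime_product :: "(nat \<Rightarrow> int) \<Rightarrow> rat" where
  "prime_product \<mu> = (\<Prod>i | 0 < i \<and> \<mu> i \<noteq> 0. of_nat (nth_prime i) powi \<mu> i)"

text \<open>
  Indices with exponent \<open>0\<close> contribute a factor \<open>1\<close>, so products for different exponent families can
  be taken over one common index set and compared factor by factor.
\<close>

lemma prime_product_eq:
  assumes "finite I" "0 \<notin> I" "\<And>i. 0 < i \<Longrightarrow> \<mu> i \<noteq> 0 \<Longrightarrow> i \<in> I"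
  shows "prime_product \<mu> = (\<Prod>i\<in>I. of_nat (nth_prime i) powi \<mu> i)"
  unfolding prime_product_def
proof (rule prod.mono_neutral_left)
  show "\<forall>i\<in>I - {i. 0 < i \<and> \<mu> i \<noteq> 0}. (of_nat (nth_prime i) :: rat) powi \<mu> i = 1"
    using assms(2) by auto (metis gr0I)
qed (use assms in auto)

lemma prime_product_pos: "0 < prime_product \<mu>"
  unfolding prime_product_def
  by (intro prod_pos) simp

lemma prime_product_add:
  assumes "finite {i. \<mu> i \<noteq> 0}" "finite {i. \<nu> i \<noteq> 0}"
  shows "prime_product (\<lambda>i. \<mu> i + \<nu> i) = prime_product \<mu> * prime_product \<nu>"
proof -
  define I where "I = ({i. \<mu> i \<noteq> 0} \<union> {i. \<nu> i \<noteq> 0}) - {0}"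
  have I: "finite I" "0 \<notin> I" using assms by (auto simp: I_def)
  have eq: "prime_product \<rho> = (\<Prod>i\<in>I. of_nat (nth_prime i) powi \<rho> i)"
    if "\<And>i. \<rho> i \<noteq> 0 \<Longrightarrow> \<mu> i \<noteq> 0 \<or> \<nu> i \<noteq> 0" for \<rho>
    using I that by (intro prime_product_eq) (auto simp: I_def)
  show ?thesis
    using eq[of "\<lambda>i. \<mu> i + \<nu> i"] eq[of \<mu>] eq[of \<nu>] by (auto simp: power_int_add prod.distrib)
qed

lemma prime_product_diff:
  fixes e d :: "nat \<Rightarrow> nat"
  assumes "finite I" "0 \<notin> I" "\<And>i. 0 < i \<Longrightarrow> int (e i) - int (d i) \<noteq> 0 \<Longrightarrow> i \<in> I"
  shows "prime_product (\<lambda>i. int (e i) - int (d i)) =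
    of_nat (\<Prod>i\<in>I. nth_prime i ^ e i) / of_nat (\<Prod>i\<in>I. nth_prime i ^ d i)"
proof -
  have "prime_product (\<lambda>i. int (e i) - int (d i)) =
      (\<Prod>i\<in>I. of_nat (nth_prime i) powi (int (e i) - int (d i)))"
    by (rule prime_product_eq) fact+
  then show ?thesis by (simp add: power_int_diff prod_dividef)
qed

text \<open>
  A product equal to \<open>1\<close> says that the primes with positive exponent and those with negative
  exponent have the same natural product, and a natural number determines its multiplicities.
\<close>

lemma prime_product_eq_1D:
  assumes fin: "finite {i. \<mu> i \<noteq> 0}" and one: "prime_product \<mu> = 1" and i: "0 < i"
  shows "\<mu> i = 0"
proof -
  define I where "I = insert i {i. \<mu> i \<noteq> 0} - {0}"
  have I: "finite I" "0 \<notin> I" "i \<in> I" using fin i by (auto simp: I_def)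
  define P where "P = (\<Prod>i\<in>I. nth_prime i ^ nat (\<mu> i))"
  define N where "N = (\<Prod>i\<in>I. nth_prime i ^ nat (- \<mu> i))"
  have split: "\<mu> = (\<lambda>i. int (nat (\<mu> i)) - int (nat (- \<mu> i)))" by auto
  have "prime_product \<mu> = of_nat P / of_nat N"
    unfolding P_def N_def by (subst split, rule prime_product_diff) (use I in \<open>auto simp: I_def\<close>)
  moreover have "N \<noteq> 0"
    using I(1) by (simp add: N_def less_imp_neq)
  ultimately have "P = N" using one by simp
  then have "multiplicity (nth_prime i) P = multiplicity (nth_prime i) N" by simp
  then have "nat (\<mu> i) = nat (- \<mu> i)"
    unfolding P_def N_def using I i by (simp add: multiplicity_prod_nth_prime)
  then show ?thesis by simp
qed

text \<open>
  Any fraction representing \<open>q\<close> will do, reduced or not: common factors of numerator and denominator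
  cancel in the difference of the multiplicities.
\<close>

lemma prime_product_surj:
  assumes "0 < q"
  obtains \<mu> where "finite {i. \<mu> i \<noteq> 0}" "prime_product \<mu> = q"
proof -
  obtain a b :: nat where ab: "0 < a" "0 < b" "q = of_nat a / of_nat b"
  proof -
    obtain m n where mn: "q = Fract m n" "0 < n" by (cases q) auto
    with assms have "0 < m" by (simp add: zero_less_Fract_iff)
    with mn show thesis
      by (intro that[of "nat m" "nat n"]) (auto simp: Fract_of_int_quotient)
  qed
  define I where "I = {i. 0 < i \<and> nth_prime i dvd a * b}"
  have "inj_on nth_prime I" using nth_prime_eq_iff by (auto simp: inj_on_def I_def)
  moreover have "finite (nth_prime ` I)"
    by (rule finite_subset[of _ "{d. d dvd a * b}"]) (use ab in \<open>auto simp: I_def\<close>)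
  ultimately have "finite I" by (metis finite_imageD)
  then have I: "finite I" "0 \<notin> I" by (simp_all add: I_def)
  \<comment> \<open>The index \<open>0\<close> names the prime \<open>2\<close> a second time, so its exponent is set to \<open>0\<close>: then the support
    of \<open>\<mu>\<close> lies in \<open>I\<close>.\<close>
  define \<mu> where "\<mu> = (\<lambda>i. if i = 0 then 0 else
    int (multiplicity (nth_prime i) a) - int (multiplicity (nth_prime i) b))"
  have supp: "i \<in> I" if "0 < i"
    "int (multiplicity (nth_prime i) a) - int (multiplicity (nth_prime i) b) \<noteq> 0" for i
    using that by (cases "nth_prime i dvd a"; cases "nth_prime i dvd b")
      (simp_all add: I_def not_dvd_imp_multiplicity_0)
  have factor_a: "(\<Prod>i\<in>I. nth_prime i ^ multiplicity (nth_prime i) a) = a"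
    by (rule prod_nth_prime_multiplicity[OF I ab(1)]) (simp add: I_def)
  have factor_b: "(\<Prod>i\<in>I. nth_prime i ^ multiplicity (nth_prime i) b) = b"
    by (rule prod_nth_prime_multiplicity[OF I ab(2)]) (simp add: I_def)
  have "prime_product \<mu> = prime_product
      (\<lambda>i. int (multiplicity (nth_prime i) a) - int (multiplicity (nth_prime i) b))"
    unfolding prime_product_def by (rule prod.cong) (auto simp: \<mu>_def)
  also have "\<dots> = of_nat (\<Prod>i\<in>I. nth_prime i ^ multiplicity (nth_prime i) a) /
      of_nat (\<Prod>i\<in>I. nth_prime i ^ multiplicity (nth_prime i) b)"
    by (rule prime_product_diff[OF I supp])
  also have "\<dots> = q"
    by (simp only: ab(3) factor_a factor_b)
  finally have "prime_product \<mu> = q" .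
  moreover have "finite {i. \<mu> i \<noteq> 0}"
    by (rule finite_subset[OF _ I(1)]) (use supp in \<open>auto simp: \<mu>_def\<close>)
  ultimately show thesis by (rule that[rotated])
qed

lemma prime_product_cong:
  assumes "\<And>i. 0 < i \<Longrightarrow> \<mu> i = \<nu> i"
  shows "prime_product \<mu> = prime_product \<nu>"
  unfolding prime_product_def by (rule prod.cong) (use assms in auto)

text \<open>
  Partition multiplication adds exponents at positive part sizes only; \<open>prime_product_cong\<close> transfers
  this because the product does not see the index \<open>0\<close>.
\<close>

lemma prime_product_signed_mult_hom:
  "(\<lambda>a. prime_product (signed_mult a)) \<in> hom overpartition_group pos_rat_group"
proof (rule homI)
  fix a b
  have "prime_product (signed_mult (partition_mult a b))
      = prime_product (\<lambda>i. signed_mult a i + signed_mult b i)"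
    by (intro prime_product_cong signed_mult_partition_mult)
  then show "prime_product (signed_mult (a \<otimes>\<^bsub>overpartition_group\<^esub> b)) =
      prime_product (signed_mult a) \<otimes>\<^bsub>pos_rat_group\<^esub> prime_product (signed_mult b)"
    by (simp add: overpartition_group_def pos_rat_group_def prime_product_add finite_signed_mult)
qed (simp add: pos_rat_group_def prime_product_pos)

theorem theorem4:
  shows "overpartition_group \<cong> pos_rat_group"
proof -
  let ?f = "\<lambda>a. prime_product (signed_mult a)"
  interpret group_hom overpartition_group pos_rat_group ?f
    using comm_group_overpartition_group comm_group_pos_rat_group prime_product_signed_mult_hom
    by (intro group_hom.intro group_hom_axioms.intro) (simp_all add: comm_group_def)
  have "a = \<one>\<^bsub>overpartition_group\<^esub>"
    if a: "a \<in> carrier overpartition_group" and "?f a = \<one>\<^bsub>pos_rat_group\<^esub>" for a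
  proof -
    have "?f a = 1" using that(2) by (simp add: pos_rat_group_def)
    then have "signed_mult a i = 0" if "0 < i" for i
      using that by (rule prime_product_eq_1D[OF finite_signed_mult])
    then have "a = ([], {})"
      using a by (intro signed_mult_inject)
        (simp_all add: overpartition_group_def empty_overpartition signed_mult_empty)
    then show ?thesis by (simp add: overpartition_group_def)
  qed
  moreover have "carrier pos_rat_group \<subseteq> ?f ` carrier overpartition_group"
  proof
    fix q assume "q \<in> carrier pos_rat_group"
    then have "0 < q" by (simp add: pos_rat_group_def)
    then obtain \<mu> where \<mu>: "finite {i. \<mu> i \<noteq> 0}" "prime_product \<mu> = q"
      by (rule prime_product_surj)
    obtain a where a: "a \<in> overpartitions" "\<And>i. 0 < i \<Longrightarrow> signed_mult a i = \<mu> i"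
      using overpartition_exists[OF \<mu>(1)] by blast
    have "prime_product (signed_mult a) = prime_product \<mu>"
      by (rule prime_product_cong) (rule a(2))
    then have "q = ?f a" using \<mu>(2) by simp
    moreover have "a \<in> carrier overpartition_group"
      using a(1) by (simp add: overpartition_group_def)
    ultimately show "q \<in> ?f ` carrier overpartition_group" by (rule image_eqI)
  qed
  ultimately have "?f \<in> iso overpartition_group pos_rat_group"
    unfolding iso_iff by blast
  then show ?thesis by (rule is_isoI)
qed

end
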